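(* For every $T\ge1$ and independent valuation distributions $\mathbf{v}_1,\ldots,\mathbf{v}_T$, $\mathbb{E}[\mathsf{ALG}^{\mathsf{Exp}}(V_1,\ldots,V_T)]=\mathbb{E}[\mathsf{ALG}^{\mathsf{A1}}(V_1,\ldots,V_T)]$, where $V_t\sim\mathbf{v}_t$ independently and expectations are over valuations and the algorithms' randomness. Since $\mathbb{E}[\mathsf{ALG}^{\mathsf{A1}}(V_1,\ldots,V_T)]=\frac1q\mathsf{OPT}(V_1,\ldots,V_T)$ for every realization of the valuations (expectation over the algorithm's randomness), $\mathsf{Exp}$ is $c^*(\mathcal{P})$-competitive, i.e. $\mathbb{E}[\mathsf{ALG}^{\mathsf{Exp}}]\ge c^*(\mathcal{P})\,\mathbb{E}[\mathsf{OPT}(V_1,\ldots,V_T)]$ for all $T$ and $\mathbf{v}_1,\ldots,\mathbf{v}_T$.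
   Context: Setting (single-item dynamic pricing, public pricing, stochastic valuations). Fix $m\ge1$, prices $0<r^{(1)}<\cdots<r^{(m)}$, $\mathcal{P}=\{r^{(1)},\ldots,r^{(m)}\}$, $r^{(0)}=0$, $r^{(m+1)}=\infty$, inventory $k\ge1$. Customer $t=1,\ldots,T$ ($T$ unknown) has valuation $V_t\in\{r^{(0)},\ldots,r^{(m)}\}$ drawn independently from a distribution $\mathbf{v}_t$. A public pricing algorithm chooses a (possibly random) price $P_t\in\{r^{(1)},\ldots,r^{(m+1)}\}$ before seeing anything about customer $t$, using past prices, sales and $\mathbf{v}_1,\ldots,\mathbf{v}_{t-1}$; it must set $P_t=\infty$ when out of inventory. $X_t=\mathbb{1}(V_t\ge P_t)$, $\mathsf{ALG}=\sum_tP_tX_t$, $I_t=k-\sum_{t'\le t}X_{t'}$. $\mathsf{OPT}(V_1,\ldots,V_T)$ is the sum of the $\min\{k,T\}$ largest valuations. An algorithm is $c$-competitive if $\mathbb{E}[\mathsf{ALG}]/\mathbb{E}[\mathsf{OPT}]\ge c$ for all $T$ and all $\mathbf{v}_1,\ldots,\mathbf{v}_T$. Let $q^{(j)}=1-r^{(j-1)}/r^{(j)}$, $q=\sum_jq^{(j)}$, $c^*(\mathcal{P})=1/q$. Algorithm VT ($\mathsf{A1}$): initialize $\mathtt{level}[i]=0$, $\mathtt{sold}[i]=\mathtt{false}$ for $i=1,\ldots,k$. For each customer $t$: let $i^*_t$ minimize $\mathtt{level}[i]$ (fixed deterministic tie-breaking), and $\ell_t$ satisfy $\mathtt{level}[i^*_t]=r^{(\ell_t)}$.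 If $\mathtt{sold}[i^*_t]=\mathtt{false}$, choose price $r^{(j)}$, $j\in\{\ell_t+1,\ldots,m\}$, w.p. $q^{(j)}/\sum_{j'=\ell_t+1}^mq^{(j')}$; else price $\infty$. Then observe $V_t,X_t$, set $\mathtt{level}[i^*_t]=\max\{\mathtt{level}[i^*_t],V_t\}$, and if $X_t=1$ set $\mathtt{sold}[i^*_t]=\mathtt{true}$. Algorithm $\mathsf{Exp}$: at time $t$, having observed $\mathbf{v}_1,\ldots,\mathbf{v}_{t-1}$ and having $k'$ units remaining, consider a run of Algorithm VT in which $V_1,\ldots,V_{t-1}$ are drawn independently from $\mathbf{v}_1,\ldots,\mathbf{v}_{t-1}$; if $\Pr[I^{\mathsf{A1}}_{t-1}=k']>0$, choose price $r^{(j)}$ with probability $\Pr[P^{\mathsf{A1}}_t=r^{(j)}\mid I^{\mathsf{A1}}_{t-1}=k']$ for $j\in\{1,\ldots,m+1\}$; otherwise choose $\infty$. *)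

theory Defs
  imports "HOL-Probability.Probability"
begin

text \<open>
  The function \<open>r\<close> is only meaningful on \<open>{0..m}\<close>; the index \<open>m + 1\<close> stands for the price \<open>\<infinity>\<close>.
\<close>

definition price :: "nat \<Rightarrow> (nat \<Rightarrow> real) \<Rightarrow> nat \<Rightarrow> ereal" where
  "price m r j = (if j \<le> m then ereal (r j) else \<infinity>)"

definition q :: "(nat \<Rightarrow> real) \<Rightarrow> nat \<Rightarrow> real" where
  "q r j = 1 - r (j - 1) / r j"

definition c_star :: "nat \<Rightarrow> (nat \<Rightarrow> real) \<Rightarrow> real" where
  "c_star m r = 1 / (\<Sum>j = 1..m. q r j)"

definition valuation_dist :: "nat \<Rightarrow> (nat \<Rightarrow> real) \<Rightarrow> real pmf \<Rightarrow> bool" where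
  "valuation_dist m r v \<longleftrightarrow> set_pmf v \<subseteq> r ` {0..m}"

text \<open>Customers are numbered from 1; the value 0 outside \<open>{1..T}\<close> is a dummy.\<close>

definition valuations :: "nat \<Rightarrow> (nat \<Rightarrow> real pmf) \<Rightarrow> (nat \<Rightarrow> real) pmf" where
  "valuations T v = Pi_pmf {1..T} 0 v"

definition OPT :: "nat \<Rightarrow> nat \<Rightarrow> (nat \<Rightarrow> real) \<Rightarrow> real" where
  "OPT k T V = sum_list (take (min k T) (rev (sort (map V [1..<Suc T]))))"

text \<open>A history lists the pairs \<open>(P\<^sub>t, X\<^sub>t)\<close> in chronological order.\<close>

type_synonym history = "(ereal \<times> bool) list"

definition inventory :: "nat \<Rightarrow> history \<Rightarrow> int" where
  "inventory k h = int k - int (length (filter snd h))"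

text \<open>
  The summand is \<open>P\<^sub>t X\<^sub>t\<close> with \<open>\<infinity> \<cdot> 0 = 0\<close>; a sale never occurs at price \<open>\<infinity>\<close>.
\<close>

definition revenue :: "history \<Rightarrow> real" where
  "revenue h = (\<Sum>(p, x)\<leftarrow>h. if x then real_of_ereal p else 0)"

text \<open>
  The price distribution for customer \<open>t\<close> is a function of the list of the first \<open>t - 1\<close>
  valuation distributions and of the history of the first \<open>t - 1\<close> customers. In particular
  neither the horizon nor past valuations are accessible.
\<close>

type_synonym pricing_alg = "real pmf list \<Rightarrow> history \<Rightarrow> ereal pmf"

definition public_pricing_algorithm ::
    "nat \<Rightarrow> nat \<Rightarrow> (nat \<Rightarrow> real) \<Rightarrow> pricing_alg \<Rightarrow> bool" where
  "public_pricing_algorithm m k r alg \<longleftrightarrow>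
     (\<forall>vs h. length h = length vs \<longrightarrow> (\<forall>v \<in> set vs. valuation_dist m r v) \<longrightarrow>
        set_pmf (alg vs h) \<subseteq> price m r ` {1..m + 1} \<and>
        (inventory k h \<le> 0 \<longrightarrow> alg vs h = return_pmf \<infinity>))"

primrec public_run :: "pricing_alg \<Rightarrow> (nat \<Rightarrow> real pmf) \<Rightarrow> (nat \<Rightarrow> real) \<Rightarrow> nat \<Rightarrow> history pmf" where
  "public_run alg v V 0 = return_pmf []"
| "public_run alg v V (Suc t) =
     do {
       h \<leftarrow> public_run alg v V t;
       p \<leftarrow> alg (map v [1..<Suc t]) h;
       return_pmf (h @ [(p, ereal (V (Suc t)) \<ge> p)])
     }"

definition expected_revenue :: "pricing_alg \<Rightarrow> (nat \<Rightarrow> real pmf) \<Rightarrow> nat \<Rightarrow> real" where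
  "expected_revenue alg v T =
     measure_pmf.expectation
       (do { V \<leftarrow> valuations T v; public_run alg v V T }) revenue"

definition competitive :: "nat \<Rightarrow> nat \<Rightarrow> (nat \<Rightarrow> real) \<Rightarrow> real \<Rightarrow> pricing_alg \<Rightarrow> bool" where
  "competitive m k r c alg \<longleftrightarrow>
     (\<forall>T \<ge> 1. \<forall>v. (\<forall>t \<in> {1..T}. valuation_dist m r (v t)) \<longrightarrow>
        expected_revenue alg v T \<ge> c * measure_pmf.expectation (valuations T v) (OPT k T))"

text \<open>
  A deterministic tie-breaking rule: the selected unit depends on the levels only.
\<close>

definition tie_breaking :: "nat \<Rightarrow> ((nat \<Rightarrow> real) \<Rightarrow> nat) \<Rightarrow> bool" where
  "tie_breaking k pick \<longleftrightarrow> (\<forall>level. is_arg_min level (\<lambda>i. i \<in> {1..k}) (pick level))"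

definition level_index :: "nat \<Rightarrow> (nat \<Rightarrow> real) \<Rightarrow> real \<Rightarrow> nat" where
  "level_index m r y = (THE l. l \<le> m \<and> r l = y)"

text \<open>
  This is a probability distribution only for \<open>l < m\<close>. A unit whose level is \<open>r m\<close> has always
  been sold, so no other \<open>l\<close> is used in a run of the algorithm.
\<close>

definition index_pmf :: "nat \<Rightarrow> (nat \<Rightarrow> real) \<Rightarrow> nat \<Rightarrow> nat pmf" where
  "index_pmf m r l =
     embed_pmf (\<lambda>j. if j \<in> {l + 1..m} then q r j / (\<Sum>j' = l + 1..m. q r j') else 0)"

definition VT_price ::
    "nat \<Rightarrow> (nat \<Rightarrow> real) \<Rightarrow> ((nat \<Rightarrow> real) \<Rightarrow> nat) \<Rightarrow> (nat \<Rightarrow> real) \<Rightarrow> (nat \<Rightarrow> bool) \<Rightarrow> ereal pmf" where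
  "VT_price m r pick level sold =
     (if sold (pick level) then return_pmf \<infinity>
      else map_pmf (price m r) (index_pmf m r (level_index m r (level (pick level)))))"

primrec VT_run ::
    "nat \<Rightarrow> (nat \<Rightarrow> real) \<Rightarrow> ((nat \<Rightarrow> real) \<Rightarrow> nat) \<Rightarrow> (nat \<Rightarrow> real) \<Rightarrow> nat \<Rightarrow>
     ((nat \<Rightarrow> real) \<times> (nat \<Rightarrow> bool) \<times> history) pmf" where
  "VT_run m r pick V 0 = return_pmf (\<lambda>_. 0, \<lambda>_. False, [])"
| "VT_run m r pick V (Suc t) =
     do {
       (level, sold, h) \<leftarrow> VT_run m r pick V t;
       p \<leftarrow> VT_price m r pick level sold;
       let i = pick level;
       let x = (ereal (V (Suc t)) \<ge> p);
       return_pmf (level(i := max (level i) (V (Suc t))),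
                   sold(i := sold i \<or> x),
                   h @ [(p, x)])
     }"

definition VT_history ::
    "nat \<Rightarrow> (nat \<Rightarrow> real) \<Rightarrow> ((nat \<Rightarrow> real) \<Rightarrow> nat) \<Rightarrow> (nat \<Rightarrow> real) \<Rightarrow> nat \<Rightarrow> history pmf" where
  "VT_history m r pick V T = map_pmf (\<lambda>(level, sold, h). h) (VT_run m r pick V T)"

text \<open>
  Joint law of \<open>(I\<^sub>t\<^sub>-\<^sub>1, P\<^sub>t)\<close> for the valuation tracking algorithm, where \<open>vs\<close> lists the first
  \<open>t - 1\<close> valuation distributions.
\<close>

definition VT_inventory_price ::
    "nat \<Rightarrow> nat \<Rightarrow> (nat \<Rightarrow> real) \<Rightarrow> ((nat \<Rightarrow> real) \<Rightarrow> nat) \<Rightarrow> real pmf list \<Rightarrow> (int \<times> ereal) pmf" where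
  "VT_inventory_price m k r pick vs =
     do {
       V \<leftarrow> valuations (length vs) (\<lambda>s. vs ! (s - 1));
       (level, sold, h) \<leftarrow> VT_run m r pick V (length vs);
       p \<leftarrow> VT_price m r pick level sold;
       return_pmf (inventory k h, p)
     }"

definition Exp_alg ::
    "nat \<Rightarrow> nat \<Rightarrow> (nat \<Rightarrow> real) \<Rightarrow> ((nat \<Rightarrow> real) \<Rightarrow> nat) \<Rightarrow> pricing_alg" where
  "Exp_alg m k r pick vs h =
     (let D = VT_inventory_price m k r pick vs;
          E = {(k', p). k' = inventory k h}
      in if measure_pmf.prob D E > 0 then map_pmf snd (cond_pmf D E) else return_pmf \<infinity>)"

end

theory Submission
  imports Defs
begin

text \<open>
  For fixed valuations the levels of VT evolve deterministically, and they always form the multiset of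
  the \<open>k\<close> largest valuations seen so far. A unit at level \<open>r\<^sup>(\<^sup>l\<^sup>)\<close> is unsold
  with probability exactly \<open>(\<Sum>j>l. q\<^sup>(\<^sup>j\<^sup>)) / q\<close>, so price \<open>r\<^sup>(\<^sup>j\<^sup>)\<close> is offered with
  unconditional probability \<open>q\<^sup>(\<^sup>j\<^sup>) / q\<close>, and raising a level from \<open>x\<close> to \<open>y\<close> earns
  \<open>(y - x) / q\<close> in expectation because \<open>q\<^sup>(\<^sup>j\<^sup>) r\<^sup>(\<^sup>j\<^sup>) = r\<^sup>(\<^sup>j\<^sup>) - r\<^sup>(\<^sup>j\<^sup>-\<^sup>1\<^sup>)\<close> telescopes.
  Since \<open>V\<^sub>t\<close> is independent of the past, the law of \<open>(I\<^sub>t\<^sub>-\<^sub>1, P\<^sub>t)\<close> determines both the expected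
  revenue from customer \<open>t\<close> and the law of \<open>I\<^sub>t\<close>; by induction this law is the same for Exp and VT.
\<close>

section \<open>Finitely supported expectations, sorted insertion and history bookkeeping\<close>

lemma finite_set_bind_pmf:
  "finite (set_pmf p) \<Longrightarrow> (\<And>x. x \<in> set_pmf p \<Longrightarrow> finite (set_pmf (f x))) \<Longrightarrow> finite (set_pmf (bind_pmf p f))"
  by simp

text \<open>Tower rule for expectations; finite supports take the place of integrability
  conditions.\<close>

lemma expectation_bind_finite:
  fixes g :: "'b \<Rightarrow> real"
  assumes "finite (set_pmf p)" "\<And>x. x \<in> set_pmf p \<Longrightarrow> finite (set_pmf (f x))"
  shows "measure_pmf.expectation (bind_pmf p f) g =
           measure_pmf.expectation p (\<lambda>x. measure_pmf.expectation (f x) g)"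
proof -
  have "measure_pmf.expectation (bind_pmf p f) g =
      (\<Sum>a\<in>set_pmf p. pmf p a *\<^sub>R measure_pmf.expectation (f a) g)"
    by (rule pmf_expectation_bind) (use assms in auto)
  also have "\<dots> = measure_pmf.expectation p (\<lambda>x. measure_pmf.expectation (f x) g)"
    by (rule integral_measure_pmf[symmetric]) (use assms in auto)
  finally show ?thesis .
qed

lemma sort_snoc: "sort (xs @ [v]) = insort v (sort xs)"
  by (rule properties_for_sort) (simp_all add: sorted_insort)

text \<open>If \<open>v \<le> xs ! n\<close>, then \<open>v\<close> lands at or before position
  \<open>n\<close>, and the extra drop leaves \<open>drop n xs\<close>. Otherwise
  \<open>xs ! n\<close> falls into the dropped prefix and \<open>v\<close> enters the suffix. This
  is how the \<open>k\<close> largest values react to one more valuation.\<close>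

lemma mset_drop_insort:
  fixes v :: "'a :: linorder"
  assumes "sorted xs" "n < length xs"
  shows "mset (drop (Suc n) (insort v xs)) = mset (drop n xs) - {#xs ! n#} + {#max (xs ! n) v#}"
  using assms
proof (induction xs arbitrary: n)
  case (Cons x xs)
  show ?case
  proof (cases n)
    case 0
    then show ?thesis by (auto simp: max_def)
  next
    case (Suc n')
    with Cons.prems have n': "n' < length xs" by simp
    show ?thesis
    proof (cases "v \<le> x")
      case True
      moreover have "x \<le> xs ! n'" using Cons.prems n' by auto
      ultimately have "max (xs ! n') v = xs ! n'" by (intro max_absorb1) order
      then show ?thesis using True n' Suc
        by (simp add: in_set_conv_nth flip: Cons_nth_drop_Suc)
    next
      case False
      then show ?thesis using Cons.IH[OF _ n'] Cons.prems Suc by simp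
    qed
  qed
qed simp

lemma revenue_snoc: "revenue (h @ [(p, x)]) = revenue h + (if x then real_of_ereal p else 0)"
  by (simp add: revenue_def)

lemma inventory_snoc: "inventory k (h @ [(p, x)]) = inventory k h - (if x then 1 else 0)"
  by (simp add: inventory_def)

lemma expectation_cong_pmf:
  "(\<And>x. x \<in> set_pmf p \<Longrightarrow> f x = g x) \<Longrightarrow>
     measure_pmf.expectation p f = measure_pmf.expectation p (g :: 'a \<Rightarrow> real)"
  by (rule integral_cong_AE) (auto simp: AE_measure_pmf_iff)

lemma expectation_add_finite:
  fixes f g :: "'a \<Rightarrow> real"
  shows "finite (set_pmf p) \<Longrightarrow> measure_pmf.expectation p (\<lambda>x. f x + g x) =
     measure_pmf.expectation p f + measure_pmf.expectation p g"
  by (simp add: integrable_measure_pmf_finite)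

section \<open>Level trajectories and sequentially drawn valuations\<close>

text \<open>Neither the tie-breaking rule nor the level update looks at prices or sales, so for
  fixed valuations all runs of VT share this one trajectory.\<close>

primrec levels :: "((nat \<Rightarrow> real) \<Rightarrow> nat) \<Rightarrow> (nat \<Rightarrow> real) \<Rightarrow> nat \<Rightarrow> nat \<Rightarrow> real" where
  "levels pick V 0 = (\<lambda>_. 0)"
| "levels pick V (Suc t) =
     (levels pick V t)(pick (levels pick V t) := max (levels pick V t (pick (levels pick V t))) (V (Suc t)))"

lemma valuations_Suc:
  "valuations (Suc t) v =
     bind_pmf (v (Suc t)) (\<lambda>y. bind_pmf (valuations t v) (\<lambda>V. return_pmf (V(Suc t := y))))"
proof -
  have "{1..Suc t} = insert (Suc t) {1..t}" by auto
  then show ?thesis unfolding valuations_def by (simp add: Pi_pmf_insert')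
qed

lemma valuations_cong: "(\<And>s. s \<in> {1..t} \<Longrightarrow> v s = v' s) \<Longrightarrow> valuations t v = valuations t v'"
  unfolding valuations_def by (rule Pi_pmf_cong) auto

lemma set_valuations:
  "V \<in> set_pmf (valuations t v) \<Longrightarrow> s \<in> {1..t} \<Longrightarrow> V s \<in> set_pmf (v s)"
  unfolding valuations_def by (auto simp: set_Pi_pmf PiE_dflt_def)

lemma finite_valuation_dist: "valuation_dist m r v \<Longrightarrow> finite (set_pmf v)"
  unfolding valuation_dist_def by (rule finite_subset) auto

lemma finite_set_valuations:
  "(\<And>s. s \<in> {1..t} \<Longrightarrow> finite (set_pmf (v s))) \<Longrightarrow> finite (set_pmf (valuations t v))"
proof (induction t)
  case 0
  then show ?case by (simp add: valuations_def)
next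
  case (Suc t)
  then show ?case unfolding valuations_Suc by (auto intro!: finite_set_bind_pmf)
qed

text \<open>By \<open>adapted\<close>, the state after \<open>t\<close> customers ignores coordinate
  \<open>Suc t\<close>, so the independent draw of that valuation commutes past the earlier run and
  past the price choice. Keeping \<open>run\<close> abstract lets the lemma serve both VT and
  Exp.\<close>

lemma bind_valuations_Suc:
  assumes step: "\<And>V. run V (Suc t) = bind_pmf (run V t) (\<lambda>s. bind_pmf (K s) (\<lambda>p. return_pmf (U s p (V (Suc t)))))"
    and adapted: "\<And>V y. run (V(Suc t := y)) t = run V t"
  shows "bind_pmf (valuations (Suc t) v) (\<lambda>V. run V (Suc t)) =
    bind_pmf (bind_pmf (valuations t v) (\<lambda>V. run V t))
      (\<lambda>s. bind_pmf (K s) (\<lambda>p. bind_pmf (v (Suc t)) (\<lambda>y. return_pmf (U s p y))))"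
proof -
  have "bind_pmf (valuations (Suc t) v) (\<lambda>V. run V (Suc t)) =
     bind_pmf (v (Suc t)) (\<lambda>y. bind_pmf (bind_pmf (valuations t v) (\<lambda>V. run V t))
        (\<lambda>s. bind_pmf (K s) (\<lambda>p. return_pmf (U s p y))))"
    by (simp add: valuations_Suc step adapted bind_assoc_pmf bind_return_pmf)
  also have "\<dots> = bind_pmf (bind_pmf (valuations t v) (\<lambda>V. run V t))
     (\<lambda>s. bind_pmf (v (Suc t)) (\<lambda>y. bind_pmf (K s) (\<lambda>p. return_pmf (U s p y))))"
    by (rule bind_commute_pmf)
  also have "\<dots> = bind_pmf (bind_pmf (valuations t v) (\<lambda>V. run V t))
     (\<lambda>s. bind_pmf (K s) (\<lambda>p. bind_pmf (v (Suc t)) (\<lambda>y. return_pmf (U s p y))))"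
    by (subst bind_commute_pmf) (rule refl)
  finally show ?thesis .
qed

lemma VT_run_cong:
  "(\<And>s. s \<in> {1..t} \<Longrightarrow> V s = V' s) \<Longrightarrow> VT_run m r pick V t = VT_run m r pick V' t"
  by (induction t) auto

lemma public_run_cong:
  "(\<And>s. s \<in> {1..t} \<Longrightarrow> V s = V' s) \<Longrightarrow> public_run alg v V t = public_run alg v V' t"
  by (induction t) auto

lemma length_public_run: "h \<in> set_pmf (public_run alg v V t) \<Longrightarrow> length h = t"
  by (induction t arbitrary: h) auto

section \<open>The joint law of current inventory and next price\<close>

text \<open>The state type is left open and read through \<open>hist\<close>: states of VT carry
  levels and sold flags, whereas states of Exp are bare histories.\<close>

definition inventory_price :: "nat \<Rightarrow> ('a \<Rightarrow> history) \<Rightarrow> 'a pmf \<Rightarrow> ('a \<Rightarrow> ereal pmf) \<Rightarrow> (int \<times> ereal) pmf" where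
  "inventory_price k hist S K = bind_pmf S (\<lambda>s. map_pmf (\<lambda>p. (inventory k (hist s), p)) (K s))"

lemma map_fst_inventory_price:
  "map_pmf fst (inventory_price k hist S K) = map_pmf (\<lambda>s. inventory k (hist s)) S"
  by (simp add: inventory_price_def map_bind_pmf pmf.map_comp o_def map_pmf_const)
     (simp add: map_pmf_def)

text \<open>The next inventory and the expected revenue increment are functions of the law of
  \<open>(I\<^sub>t\<^sub>-\<^sub>1, P\<^sub>t)\<close> alone, because \<open>V\<^sub>t\<close> is independent of the past.\<close>

lemma inventory_step:
  assumes "\<And>s p y. hist (U s p y) = hist s @ [(p, p \<le> ereal y)]"
  shows "map_pmf (\<lambda>s. inventory k (hist s)) (bind_pmf S (\<lambda>s. bind_pmf (K s) (\<lambda>p. bind_pmf w (\<lambda>y. return_pmf (U s p y))))) =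
    bind_pmf (inventory_price k hist S K)
      (\<lambda>(i, p). map_pmf (\<lambda>y. i - (if p \<le> ereal y then 1 else 0)) w)"
  by (simp add: inventory_price_def map_bind_pmf bind_assoc_pmf bind_map_pmf assms inventory_snoc)
     (simp add: map_pmf_def)

lemma revenue_step:
  assumes hist: "\<And>s p y. hist (U s p y) = hist s @ [(p, p \<le> ereal y)]"
    and fin: "finite (set_pmf S)" "\<And>s. s \<in> set_pmf S \<Longrightarrow> finite (set_pmf (K s))" "finite (set_pmf w)"
  shows "measure_pmf.expectation (bind_pmf S (\<lambda>s. bind_pmf (K s) (\<lambda>p. bind_pmf w (\<lambda>y. return_pmf (U s p y)))))
           (\<lambda>s. revenue (hist s)) =
    measure_pmf.expectation S (\<lambda>s. revenue (hist s)) +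
    measure_pmf.expectation (inventory_price k hist S K)
      (\<lambda>(i, p). measure_pmf.expectation w (\<lambda>y. if p \<le> ereal y then real_of_ereal p else 0))"
proof -
  let ?g = "\<lambda>p. measure_pmf.expectation w (\<lambda>y. if p \<le> ereal y then real_of_ereal p else 0)"
  have "measure_pmf.expectation (bind_pmf S (\<lambda>s. bind_pmf (K s) (\<lambda>p. bind_pmf w (\<lambda>y. return_pmf (U s p y)))))
           (\<lambda>s. revenue (hist s)) =
      measure_pmf.expectation S (\<lambda>s. revenue (hist s) + measure_pmf.expectation (K s) ?g)"
  proof (subst expectation_bind_finite)
    show "measure_pmf.expectation S (\<lambda>s. measure_pmf.expectation
            (bind_pmf (K s) (\<lambda>p. bind_pmf w (\<lambda>y. return_pmf (U s p y)))) (\<lambda>s. revenue (hist s))) =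
        measure_pmf.expectation S (\<lambda>s. revenue (hist s) + measure_pmf.expectation (K s) ?g)"
    proof (rule expectation_cong_pmf)
      fix s assume s: "s \<in> set_pmf S"
      show "measure_pmf.expectation
            (bind_pmf (K s) (\<lambda>p. bind_pmf w (\<lambda>y. return_pmf (U s p y)))) (\<lambda>s. revenue (hist s)) =
          revenue (hist s) + measure_pmf.expectation (K s) ?g"
        using fin(2)[OF s] fin(3)
        by (simp add: expectation_bind_finite hist revenue_snoc expectation_add_finite)
    qed
  qed (use fin in \<open>auto intro!: finite_set_bind_pmf\<close>)
  also have "\<dots> = measure_pmf.expectation S (\<lambda>s. revenue (hist s)) +
      measure_pmf.expectation S (\<lambda>s. measure_pmf.expectation (K s) ?g)"
    using fin by (rule_tac expectation_add_finite)
  also have "measure_pmf.expectation S (\<lambda>s. measure_pmf.expectation (K s) ?g) =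
      measure_pmf.expectation (inventory_price k hist S K) (\<lambda>(i, p). ?g p)"
    unfolding inventory_price_def
    by (subst expectation_bind_finite) (use fin in auto)
  finally show ?thesis .
qed

text \<open>Disintegration: a law is recovered from its first marginal and its conditional laws.
  Only inventories in the support of \<open>D\<close> are constrained, which suffices because
  \<open>law\<close> makes the supports of the two marginals equal.\<close>

lemma inventory_price_conditional:
  assumes law: "map_pmf fst D = map_pmf (\<lambda>s. inventory k (hist s)) S"
    and K: "\<And>s. s \<in> set_pmf S \<Longrightarrow> inventory k (hist s) \<in> fst ` set_pmf D \<Longrightarrow>
              K s = map_pmf snd (cond_pmf D {(i, p). i = inventory k (hist s)})"
  shows "inventory_price k hist S K = D"
proof -
  let ?R = "\<lambda>s y. fst y = inventory k (hist s)"
  have sets: "fst ` set_pmf D = (\<lambda>s. inventory k (hist s)) ` set_pmf S"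
    using arg_cong[OF law, of set_pmf] by simp
  have ne: "set_pmf D \<inter> {y. ?R s y} \<noteq> {}" if "s \<in> set_pmf S" for s
  proof -
    have "inventory k (hist s) \<in> fst ` set_pmf D" using sets that by simp
    then show ?thesis by auto
  qed
  have "inventory_price k hist S K = bind_pmf S (\<lambda>s. cond_pmf D {y. ?R s y})"
    unfolding inventory_price_def
  proof (rule bind_pmf_cong[OF refl])
    fix s assume s: "s \<in> set_pmf S"
    have E: "{(i, p). i = inventory k (hist s)} = {y. ?R s y}" by auto
    have "K s = map_pmf snd (cond_pmf D {y. ?R s y})"
      using K[OF s] sets s unfolding E by blast
    then have "map_pmf (\<lambda>p. (inventory k (hist s), p)) (K s) =
        map_pmf (\<lambda>y. (inventory k (hist s), snd y)) (cond_pmf D {y. ?R s y})"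
      by (simp add: pmf.map_comp o_def)
    \<comment> \<open>On the conditioning event the first component is the constant
      \<open>inventory k (hist s)\<close>, so putting it back in front of \<open>snd y\<close>
      restores \<open>y\<close>.\<close>
    also have "\<dots> = map_pmf id (cond_pmf D {y. ?R s y})"
      by (rule map_pmf_cong) (use ne[OF s] in \<open>auto simp: set_cond_pmf\<close>)
    finally show "map_pmf (\<lambda>p. (inventory k (hist s), p)) (K s) = cond_pmf D {y. ?R s y}"
      by simp
  qed
  also have "\<dots> = D"
  \<comment> \<open>Averaging the conditional laws over \<open>S\<close> gives \<open>D\<close> back
    because \<open>S\<close> and \<open>D\<close> put equal mass on each inventory value; this is
    what \<open>law\<close> provides.\<close>
  proof (rule bind_cond_pmf_cancel)
    fix y assume "y \<in> set_pmf D"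
    then have "fst y \<in> (\<lambda>s. inventory k (hist s)) ` set_pmf S" using sets by auto
    then show "set_pmf S \<inter> {s. ?R s y} \<noteq> {}" by auto
  next
    fix s y assume R: "?R s y"
    have "measure D {y'. ?R s y'} = measure (map_pmf fst D) {fst y}"
      using R by (simp add: vimage_def)
    also have "\<dots> = measure S {s'. ?R s' y}"
      unfolding law by (simp add: vimage_def eq_commute)
    finally show "measure D {y. ?R s y} = measure S {s. ?R s y}" .
  qed (rule ne)
  finally show ?thesis .
qed

section \<open>The price ladder and the random price index\<close>

locale vt =
  fixes m k :: nat and r :: "nat \<Rightarrow> real" and pick :: "(nat \<Rightarrow> real) \<Rightarrow> nat"
  assumes m: "m \<ge> 1" and k: "k \<ge> 1" and r0: "r 0 = 0"
    and r_mono: "strict_mono_on {0..m} r" and pick: "tie_breaking k pick"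
begin

lemma r_less_iff: "i \<le> m \<Longrightarrow> j \<le> m \<Longrightarrow> r i < r j \<longleftrightarrow> i < j"
  using strict_mono_on_less[OF r_mono] by auto

lemma r_le_iff: "i \<le> m \<Longrightarrow> j \<le> m \<Longrightarrow> r i \<le> r j \<longleftrightarrow> i \<le> j"
  using r_less_iff[of j i] by (auto simp: not_less[symmetric])

lemma r_eq_iff: "i \<le> m \<Longrightarrow> j \<le> m \<Longrightarrow> r i = r j \<longleftrightarrow> i = j"
  using r_le_iff[of i j] r_le_iff[of j i] by auto

lemma r_nonneg: "j \<le> m \<Longrightarrow> 0 \<le> r j"
  using r_le_iff[of 0 j] r0 by auto

lemma r_max: "i \<le> m \<Longrightarrow> j \<le> m \<Longrightarrow> max (r i) (r j) = r (max i j)"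
  by (auto simp: max_def r_le_iff)

lemma level_index_r: "l \<le> m \<Longrightarrow> level_index m r (r l) = l"
  unfolding level_index_def by (rule the_equality) (auto simp: r_eq_iff)

lemma pick_mem: "pick lv \<in> {1..k}"
  using pick by (auto simp: tie_breaking_def is_arg_min_def)

lemma pick_le: "i \<in> {1..k} \<Longrightarrow> lv (pick lv) \<le> lv i"
  using pick by (auto simp: tie_breaking_def is_arg_min_def not_less)

lemma q_pos:
  assumes "1 \<le> j" "j \<le> m"
  shows "q r j > 0"
proof -
  have "r (j - 1) < r j" "0 < r j"
    using assms r_less_iff[of "j - 1" j] r_less_iff[of 0 j] r0 by auto
  then show ?thesis by (simp add: q_def)
qed

lemma q_mult_price:
  assumes "1 \<le> j" "j \<le> m"
  shows "q r j * r j = r j - r (j - 1)"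
  using assms r_less_iff[of 0 j] r0 by (auto simp: q_def field_simps)

text \<open>The normalizer of \<open>index_pmf m r l\<close>. Here \<open>Q 0\<close> is the
  constant q of the competitive ratio, and \<open>Q l / Q 0\<close> will be the probability that a
  unit at level \<open>r l\<close> is unsold.\<close>

definition Q :: "nat \<Rightarrow> real" where "Q l = (\<Sum>j = l + 1..m. q r j)"

lemma Q_pos: "l < m \<Longrightarrow> Q l > 0"
  unfolding Q_def by (rule sum_pos) (auto intro: q_pos)

lemma sum_q_price:
  assumes "l \<le> v" "v \<le> m"
  shows "(\<Sum>j = l + 1..v. q r j * r j) = r v - r l"
proof -
  have "(\<Sum>j = l + 1..v. q r j * r j) = (\<Sum>j = l + 1..v. r j - r (j - 1))"
    by (rule sum.cong[OF refl], rule q_mult_price) (use assms in auto)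
  also have "\<dots> = r v - r l"
    using sum_telescope''[of l v r] assms by (simp add: atLeastSucAtMost_greaterThanAtMost)
  finally show ?thesis .
qed

lemma pmf_index:
  assumes "l < m"
  shows "pmf (index_pmf m r l) j = (if j \<in> {l + 1..m} then q r j / Q l else 0)"
proof -
  let ?f = "\<lambda>j. if j \<in> {l + 1..m} then q r j / Q l else 0"
  have nonneg: "?f j \<ge> 0" for j
    using q_pos Q_pos[OF assms] by (auto intro!: divide_nonneg_nonneg simp: less_imp_le)
  have "(\<integral>\<^sup>+ x. ennreal (?f x) \<partial>count_space UNIV) = (\<Sum>x\<in>{l + 1..m}. ennreal (?f x))"
    by (rule nn_integral_count_space') auto
  also have "\<dots> = ennreal (\<Sum>x\<in>{l + 1..m}. ?f x)"
    by (rule sum_ennreal) (rule nonneg)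
  also have "(\<Sum>x\<in>{l + 1..m}. ?f x) = 1"
    using Q_pos[OF assms] by (simp add: Q_def flip: sum_divide_distrib)
  finally show ?thesis
    unfolding index_pmf_def Q_def[symmetric] using nonneg by (subst pmf_embed_pmf) auto
qed

lemma set_index_pmf:
  assumes "l < m"
  shows "set_pmf (index_pmf m r l) = {l + 1..m}"
proof -
  have "q r j \<noteq> 0" if "j \<in> {l + 1..m}" for j using q_pos[of j] that by auto
  then show ?thesis using Q_pos[OF assms] by (auto simp: set_pmf_eq pmf_index[OF assms])
qed

lemma expectation_index:
  fixes g :: "nat \<Rightarrow> real"
  assumes "l < m"
  shows "measure_pmf.expectation (index_pmf m r l) g = (\<Sum>j = l + 1..m. q r j * g j) / Q l"
proof -
  have "measure_pmf.expectation (index_pmf m r l) g = (\<Sum>j = l + 1..m. g j * pmf (index_pmf m r l) j)"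
    by (rule integral_measure_pmf_real) (auto simp: set_index_pmf[OF assms])
  then show ?thesis
    by (simp add: pmf_index[OF assms] sum_divide_distrib mult.commute)
qed

section \<open>Invariants of a VT run\<close>

text \<open>Unsold units stay below \<open>r m\<close>, so \<open>index_pmf\<close> is only
  consulted where it is a probability distribution. The cardinality condition ties the inventory,
  which is read off the history, to the sold flags.\<close>

definition valid_state :: "nat \<Rightarrow> (nat \<Rightarrow> real) \<times> (nat \<Rightarrow> bool) \<times> history \<Rightarrow> bool" where
  "valid_state t = (\<lambda>(lv, sd, h).
     (\<forall>i. lv i \<in> r ` {0..m}) \<and> (\<forall>i. \<not> sd i \<longrightarrow> lv i < r m) \<and>
     length (filter snd h) = card {i. sd i} \<and> {i. sd i} \<subseteq> {1..k} \<and> length h = t)"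

lemma VT_price_unsold:
  assumes "valid_state t (lv, sd, h)" "\<not> sd (pick lv)"
  obtains l where "l < m" "lv (pick lv) = r l"
    "VT_price m r pick lv sd = map_pmf (price m r) (index_pmf m r l)"
proof -
  obtain l where l: "l \<le> m" "lv (pick lv) = r l"
    using assms by (force simp: valid_state_def)
  then have "l < m" using assms r_less_iff[of l m] by (auto simp: valid_state_def)
  with l show ?thesis using that assms by (auto simp: VT_price_def level_index_r)
qed

lemma set_VT_price:
  assumes "valid_state t (lv, sd, h)"
  shows "set_pmf (VT_price m r pick lv sd) \<subseteq> price m r ` {1..m + 1}"
proof (cases "sd (pick lv)")
  case True
  then show ?thesis by (auto simp: VT_price_def price_def image_iff intro!: bexI[of _ "m + 1"])
next
  case False
  obtain l where "l < m" "VT_price m r pick lv sd = map_pmf (price m r) (index_pmf m r l)"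
    using VT_price_unsold[OF assms False] by blast
  then show ?thesis by (auto simp: set_index_pmf intro!: imageI)
qed

lemma finite_VT_price: "valid_state t (lv, sd, h) \<Longrightarrow> finite (set_pmf (VT_price m r pick lv sd))"
  using finite_subset[OF set_VT_price] by blast

lemma valid_state_0: "valid_state 0 (\<lambda>_. 0, \<lambda>_. False, [])"
  using r_less_iff[of 0 m] m r0 by (auto simp: valid_state_def image_iff intro!: bexI[of _ 0])

lemma valid_state_Suc:
  assumes s: "valid_state t (lv, sd, h)" and p: "p \<in> set_pmf (VT_price m r pick lv sd)"
    and y: "y \<in> r ` {0..m}"
  shows "valid_state (Suc t) (lv(pick lv := max (lv (pick lv)) y),
           sd(pick lv := sd (pick lv) \<or> p \<le> ereal y), h @ [(p, p \<le> ereal y)])"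
proof -
  let ?i = "pick lv"
  have fin: "finite {i. sd i}"
    using s by (auto simp: valid_state_def intro: finite_subset)
  have mx: "max (lv ?i) y \<in> r ` {0..m}"
    using s y by (auto simp: valid_state_def max_def)
  show ?thesis
  proof (cases "sd ?i")
    case True
    then have "p = \<infinity>" using p by (simp add: VT_price_def)
    with True s mx show ?thesis by (auto simp: valid_state_def fun_upd_idem)
  next
    case False
    obtain l where l: "l < m" "lv ?i = r l"
      "VT_price m r pick lv sd = map_pmf (price m r) (index_pmf m r l)"
      using VT_price_unsold[OF s False] by blast
    then obtain j where j: "j \<le> m" "p = ereal (r j)"
      using p by (auto simp: set_index_pmf price_def)
    define sd' where "sd' = sd(?i := sd ?i \<or> p \<le> ereal y)"
    have eq: "{i. sd' i} = (if r j \<le> y then insert ?i {i. sd i} else {i. sd i})"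
      using False j by (auto simp: sd'_def split: if_splits)
    \<comment> \<open>A unit left unsold has seen \<open>y < r j \<le> r m\<close>, and its old
      level \<open>r l\<close> was below \<open>r m\<close>; hence so is its new level.\<close>
    have less: "max (r l) y < r m" if "y < r j"
      using that l j r_le_iff[of j m] r_less_iff[of l m] by (auto simp: max_def)
    have "{i. sd' i} \<subseteq> {1..k}"
      using s pick_mem[of lv] by (auto simp: valid_state_def eq)
    moreover have "length (filter snd (h @ [(p, p \<le> ereal y)])) = card {i. sd' i}"
      unfolding eq using s fin False j by (simp add: valid_state_def)
    moreover have "\<not> sd' i \<longrightarrow> (lv(?i := max (lv ?i) y)) i < r m" for i
      using s less l j by (auto simp: valid_state_def sd'_def)
    ultimately show ?thesis using s mx
      unfolding valid_state_def sd'_def[symmetric] by (simp del: filter_append)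
  qed
qed

lemma VT_run_valid:
  assumes "\<forall>s\<in>{1..t}. V s \<in> r ` {0..m}"
  shows "x \<in> set_pmf (VT_run m r pick V t) \<Longrightarrow> valid_state t x \<and> fst x = levels pick V t"
  using assms
proof (induction t arbitrary: x)
  case 0
  then show ?case by (simp add: valid_state_0)
next
  case (Suc t)
  obtain lv sd h p where st: "(lv, sd, h) \<in> set_pmf (VT_run m r pick V t)"
    "p \<in> set_pmf (VT_price m r pick lv sd)"
    "x = (lv(pick lv := max (lv (pick lv)) (V (Suc t))),
           sd(pick lv := sd (pick lv) \<or> p \<le> ereal (V (Suc t))), h @ [(p, p \<le> ereal (V (Suc t)))])"
    using Suc.prems(1) by (auto simp: Let_def)
  with Suc.IH[OF st(1)] Suc.prems(2) valid_state_Suc[of t lv sd h p "V (Suc t)"] show ?case by auto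
qed

lemma finite_VT_run:
  assumes "\<forall>s\<in>{1..t}. V s \<in> r ` {0..m}"
  shows "finite (set_pmf (VT_run m r pick V t))"
  using assms
proof (induction t)
  case (Suc t)
  then have "\<forall>s\<in>{1..t}. V s \<in> r ` {0..m}" by auto
  then have fin: "finite (set_pmf (VT_run m r pick V t))"
    and "\<And>x. x \<in> set_pmf (VT_run m r pick V t) \<Longrightarrow> valid_state t x"
    using Suc.IH VT_run_valid by auto
  then show ?case
    by (auto simp: Let_def intro!: finite_set_bind_pmf finite_VT_price split: prod.split)
qed simp

lemma VT_run_Suc:
  "VT_run m r pick V (Suc t) =
     bind_pmf (VT_run m r pick V t) (\<lambda>(lv, sd, h).
       bind_pmf (VT_price m r pick lv sd) (\<lambda>p.
         return_pmf (lv(pick lv := max (lv (pick lv)) (V (Suc t))),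
                   sd(pick lv := sd (pick lv) \<or> p \<le> ereal (V (Suc t))),
                   h @ [(p, p \<le> ereal (V (Suc t)))])))"
  by (simp add: Let_def)

section \<open>Levels as the largest valuations, and their sum as OPT\<close>

text \<open>Padding with \<open>k\<close> zeros, the initial levels, gives a list of length
  \<open>k + t\<close>, so dropping \<open>t\<close> always leaves \<open>k\<close> entries. VT
  updates a unit of minimal level, which is the entry that \<open>mset_drop_insort\<close>
  replaces.\<close>

lemma image_mset_levels:
  "image_mset (levels pick V t) (mset_set {1..k}) =
     mset (drop t (sort (replicate k 0 @ map V [1..<Suc t])))"
proof (induction t)
  case 0
  show ?case by (simp add: image_mset_const_eq sort_replicate)
next
  case (Suc t)
  let ?S = "sort (replicate k 0 @ map V [1..<Suc t])"
  let ?lv = "levels pick V t"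
  let ?i = "pick ?lv"
  have len: "t < length ?S" using k by simp
  have top: "set (drop t ?S) = ?lv ` {1..k}"
    using arg_cong[OF Suc.IH, of set_mset] by simp
  \<comment> \<open>Both sides are the minimum of the retained entries: the left by choice of
    \<open>pick\<close>, the right as head of a sorted suffix.\<close>
  have eq: "?lv ?i = ?S ! t"
  proof (rule antisym)
    have "?S ! t \<in> set (drop t ?S)"
      using len by (simp flip: Cons_nth_drop_Suc)
    then obtain i where "i \<in> {1..k}" "?S ! t = ?lv i"
      unfolding top by (elim imageE)
    then show "?lv ?i \<le> ?S ! t"
      using pick_le[of i ?lv] by (simp only:)
    have "?S ! t \<le> x" if "x \<in> set (drop t ?S)" for x
      using that len sorted_nth_mono[of ?S t] by (auto simp: in_set_conv_nth)
    then show "?S ! t \<le> ?lv ?i"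
      unfolding top using pick_mem[of ?lv] by blast
  qed
  have ins: "mset_set {1..k} = add_mset ?i (mset_set ({1..k} - {?i}))"
    using pick_mem[of ?lv] by (intro mset_set.remove) auto
  have "image_mset (levels pick V (Suc t)) (mset_set {1..k}) =
      image_mset ?lv (mset_set {1..k}) - {#?lv ?i#} + {#max (?lv ?i) (V (Suc t))#}"
    unfolding ins by (auto intro!: image_mset_cong)
  also have "\<dots> = mset (drop (Suc t) (insort (V (Suc t)) ?S))"
    using mset_drop_insort[of ?S t "V (Suc t)"] len unfolding Suc.IH eq by simp
  also have "insort (V (Suc t)) ?S = sort (replicate k 0 @ map V [1..<Suc (Suc t)])"
    using sort_snoc[of "replicate k 0 @ map V [1..<Suc t]" "V (Suc t)"] by simp
  finally show ?case .
qed

text \<open>Nonnegativity lets the padding zeros be sorted to the front, where they add nothing to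
  the sum.\<close>

lemma sum_levels_eq_OPT:
  assumes "\<forall>t\<in>{1..T}. 0 \<le> V t"
  shows "(\<Sum>i = 1..k. levels pick V T i) = OPT k T V"
proof -
  let ?Vs = "map V [1..<Suc T]"
  have S: "sort (replicate k 0 @ ?Vs) = replicate k 0 @ sort ?Vs"
    by (rule properties_for_sort) (use assms in \<open>auto simp: sorted_append\<close>)
  have zeros: "sum_list (replicate n 0) = (0 :: real)" for n
    by (induction n) auto
  have "(\<Sum>i = 1..k. levels pick V T i) = sum_list (drop T (replicate k 0 @ sort ?Vs))"
    unfolding sum_unfold_sum_mset image_mset_levels S by (rule sum_mset_sum_list)
  \<comment> \<open>If \<open>T \<le> k\<close>, only zeros are dropped. Otherwise all
    \<open>k\<close> zeros and the \<open>T - k\<close> smallest valuations go.\<close>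
  also have "\<dots> = sum_list (drop (T - min k T) (sort ?Vs))"
    by (cases "T \<le> k") (auto simp: zeros)
  also have "\<dots> = OPT k T V"
    unfolding OPT_def by (simp add: take_rev del: upt_Suc)
  finally show ?thesis .
qed

section \<open>Expected revenue of VT for fixed valuations\<close>

text \<open>An unsold unit at level \<open>r l\<close> meets valuation \<open>r v\<close>. The price
  indices that fail to sell are those above \<open>max l v\<close>, with total weight
  \<open>Q (max l v)\<close>; over those that sell, the products of weight and price
  telescope.\<close>

lemma expectation_price:
  assumes "l < m" "v \<le> m"
  shows "measure_pmf.expectation (map_pmf (price m r) (index_pmf m r l)) (\<lambda>p. of_bool (\<not> p \<le> ereal (r v))) =
           Q (max l v) / Q l" (is ?unsold)
    and "measure_pmf.expectation (map_pmf (price m r) (index_pmf m r l))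
             (\<lambda>p. if p \<le> ereal (r v) then real_of_ereal p else 0) = (r (max l v) - r l) / Q l" (is ?revenue)
proof -
  let ?w = "max l v"
  have "(\<Sum>j = l + 1..m. q r j * of_bool (\<not> price m r j \<le> ereal (r v))) =
      (\<Sum>j = l + 1..m. if ?w + 1 \<le> j then q r j else 0)"
    by (rule sum.cong) (use assms in \<open>auto simp: price_def r_le_iff\<close>)
  also have "\<dots> = (\<Sum>j \<in> {j \<in> {l + 1..m}. ?w + 1 \<le> j}. q r j)"
    by (rule sum.inter_filter[symmetric]) simp
  also have "{j \<in> {l + 1..m}. ?w + 1 \<le> j} = {?w + 1..m}" by auto
  finally show ?unsold
    using assms by (simp add: expectation_index Q_def)
  have "(\<Sum>j = l + 1..m. q r j * (if price m r j \<le> ereal (r v) then real_of_ereal (price m r j) else 0)) =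
      (\<Sum>j = l + 1..m. if j \<le> ?w then q r j * r j else 0)"
    by (rule sum.cong) (use assms in \<open>auto simp: price_def r_le_iff\<close>)
  also have "\<dots> = (\<Sum>j \<in> {j \<in> {l + 1..m}. j \<le> ?w}. q r j * r j)"
    by (rule sum.inter_filter[symmetric]) simp
  also have "{j \<in> {l + 1..m}. j \<le> ?w} = {l + 1..?w}" using assms by auto
  also have "(\<Sum>j \<in> {l + 1..?w}. q r j * r j) = r ?w - r l"
    using assms by (intro sum_q_price) auto
  finally show ?revenue
    using assms by (simp add: expectation_index)
qed

text \<open>Both claims are proved by one induction, since the revenue increment is weighted by the
  probability that the selected unit is unsold. The factor \<open>Q l\<close> in that probability
  cancels the normalizer of the price distribution.\<close>

lemma expectation_VT_run:
  assumes "\<forall>s\<in>{1..t}. V s \<in> r ` {0..m}"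
  shows "(\<forall>i. measure_pmf.expectation (VT_run m r pick V t) (\<lambda>(lv, sd, h). of_bool (\<not> sd i)) =
             Q (level_index m r (levels pick V t i)) / Q 0) \<and>
         measure_pmf.expectation (VT_run m r pick V t) (\<lambda>(lv, sd, h). revenue h) =
             (\<Sum>i = 1..k. levels pick V t i) / Q 0"
  using assms
proof (induction t)
  case 0
  have "Q 0 > 0" using m Q_pos by simp
  then show ?case using level_index_r[of 0] r0 by (simp add: revenue_def)
next
  case (Suc t)
  let ?R = "VT_run m r pick V t"
  let ?lv = "levels pick V t"
  let ?i = "pick ?lv"
  have V: "\<forall>s\<in>{1..t}. V s \<in> r ` {0..m}" using Suc.prems by auto
  note IH = Suc.IH[OF V]
  note fin = finite_VT_run[OF V]
  have val: "valid_state t x" "fst x = ?lv" if "x \<in> set_pmf ?R" for x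
    using VT_run_valid[OF V that] by auto
  obtain v where v: "v \<le> m" "V (Suc t) = r v" using Suc.prems by force
  \<comment> \<open>The levels are the same in every run, so a single run in the support shows that
    the selected level lies on the price ladder.\<close>
  obtain x where "x \<in> set_pmf ?R" using set_pmf_not_empty by fast
  with val[of x] obtain l where l: "l \<le> m" "?lv ?i = r l"
    by (cases x) (force simp: valid_state_def)
  let ?w = "max l v"
  have w: "?w \<le> m" using l v by simp
  have lv': "levels pick V (Suc t) = ?lv(?i := r ?w)"
    using l v by (simp add: r_max)
  \<comment> \<open>With deterministic levels, the selected unit and its new level are constants
    under the expectation; only the sold flags and the history remain random.\<close>
  have step: "measure_pmf.expectation (VT_run m r pick V (Suc t)) g =
      measure_pmf.expectation ?R (\<lambda>(lv, sd, h). measure_pmf.expectation (VT_price m r pick ?lv sd)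
        (\<lambda>p. g (?lv(?i := r ?w), sd(?i := sd ?i \<or> p \<le> ereal (r v)), h @ [(p, p \<le> ereal (r v))])))"
    for g :: "_ \<Rightarrow> real"
    unfolding VT_run_Suc
  proof (subst expectation_bind_finite)
    show "finite (set_pmf (case x of (lv, sd, h) \<Rightarrow> bind_pmf (VT_price m r pick lv sd) (\<lambda>p.
         return_pmf (lv(pick lv := max (lv (pick lv)) (V (Suc t))),
                   sd(pick lv := sd (pick lv) \<or> p \<le> ereal (V (Suc t))),
                   h @ [(p, p \<le> ereal (V (Suc t)))]))))" if "x \<in> set_pmf ?R" for x
      using val(1)[OF that] by (cases x) (simp add: finite_VT_price)
  next
    have price_fin: "finite (set_pmf (VT_price m r pick ?lv sd))" if "(lv, sd, h) \<in> set_pmf ?R" for lv sd h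
      using val[OF that] finite_VT_price by auto
    show "measure_pmf.expectation ?R (\<lambda>x. measure_pmf.expectation
         (case x of (lv, sd, h) \<Rightarrow> bind_pmf (VT_price m r pick lv sd) (\<lambda>p.
           return_pmf (lv(pick lv := max (lv (pick lv)) (V (Suc t))),
                   sd(pick lv := sd (pick lv) \<or> p \<le> ereal (V (Suc t))),
                   h @ [(p, p \<le> ereal (V (Suc t)))]))) g) =
      measure_pmf.expectation ?R (\<lambda>(lv, sd, h). measure_pmf.expectation (VT_price m r pick ?lv sd)
        (\<lambda>p. g (?lv(?i := r ?w), sd(?i := sd ?i \<or> p \<le> ereal (r v)), h @ [(p, p \<le> ereal (r v))])))"
      by (rule expectation_cong_pmf)
         (use val(2) l v price_fin in \<open>auto simp: r_max expectation_bind_finite\<close>)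
  qed (rule fin)
  have cur: "measure_pmf.expectation ?R (\<lambda>(lv, sd, h). of_bool (\<not> sd ?i)) = Q l / Q 0"
    using IH l by (simp add: level_index_r)
  have price: "sd ?i \<and> VT_price m r pick ?lv sd = return_pmf \<infinity> \<or>
       \<not> sd ?i \<and> l < m \<and> VT_price m r pick ?lv sd = map_pmf (price m r) (index_pmf m r l)"
    if "(lv, sd, h) \<in> set_pmf ?R" for lv sd h
  proof (cases "sd ?i")
    case True
    then show ?thesis by (simp add: VT_price_def)
  next
    case False
    moreover have "valid_state t (?lv, sd, h)" using val[OF that] by simp
    ultimately show ?thesis using VT_price_unsold[of t ?lv sd h] l
      by (metis less_imp_le r_eq_iff)
  qed
  \<comment> \<open>For the top level \<open>l = m\<close>, where the normalizer \<open>Q l\<close>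
    vanishes: then \<open>?w = m\<close>, and both sides of the survival identity are zero.\<close>
  have Q0: "Q m = 0" by (simp add: Q_def)
  have unsold: "measure_pmf.expectation (VT_run m r pick V (Suc t)) (\<lambda>(lv, sd, h). of_bool (\<not> sd i)) =
      Q (level_index m r (levels pick V (Suc t) i)) / Q 0" for i
  proof (cases "i = ?i")
    case True
    have "measure_pmf.expectation (VT_run m r pick V (Suc t)) (\<lambda>(lv, sd, h). of_bool (\<not> sd i)) =
       measure_pmf.expectation ?R (\<lambda>x. (case x of (lv, sd, h) \<Rightarrow> of_bool (\<not> sd ?i)) * (Q ?w / Q l))"
      unfolding step True
      by (rule expectation_cong_pmf)
         (use v in \<open>auto dest!: price simp: expectation_price(1) simp del: integral_map_pmf\<close>)
    also have "\<dots> = Q ?w / Q 0"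
      using cur Q0 l w Q_pos[of l] by (cases "l = m") (auto simp: max_def)
    finally show ?thesis using True lv' w by (simp add: level_index_r)
  next
    case False
    then show ?thesis using IH unfolding step lv' by (simp add: case_prod_unfold)
  qed
  have "measure_pmf.expectation (VT_run m r pick V (Suc t)) (\<lambda>(lv, sd, h). revenue h) =
     measure_pmf.expectation ?R (\<lambda>x. (case x of (lv, sd, h) \<Rightarrow> revenue h) +
       (case x of (lv, sd, h) \<Rightarrow> of_bool (\<not> sd ?i)) * ((r ?w - r l) / Q l))"
    unfolding step
    by (rule expectation_cong_pmf)
       (use v val in \<open>auto dest!: price simp: expectation_price(2) revenue_snoc
          expectation_add_finite set_index_pmf simp del: integral_map_pmf\<close>)
  also have "\<dots> = (\<Sum>i = 1..k. ?lv i) / Q 0 + Q l / Q 0 * ((r ?w - r l) / Q l)"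
    using IH[THEN conjunct2] cur fin
    by (subst expectation_add_finite) (simp_all only: integral_mult_left_zero)
  also have "\<dots> = ((\<Sum>i = 1..k. ?lv i) + (r ?w - r l)) / Q 0"
    using l w v Q_pos[of l] by (cases "l = m") (auto simp: max_def add_divide_distrib)
  also have "(\<Sum>i = 1..k. ?lv i) + (r ?w - r l) = (\<Sum>i = 1..k. levels pick V (Suc t) i)"
  proof -
    have "(\<Sum>i = 1..k. f i) = f ?i + (\<Sum>i\<in>{1..k} - {?i}. f i)" for f :: "nat \<Rightarrow> real"
      by (rule sum.remove) (use pick_mem in auto)
    note split = this[of ?lv] this[of "?lv(?i := r ?w)"]
    have "(\<Sum>i\<in>{1..k} - {?i}. (?lv(?i := r ?w)) i) = (\<Sum>i\<in>{1..k} - {?i}. ?lv i)"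
      by (rule sum.cong) auto
    then show ?thesis unfolding lv' split using l by simp
  qed
  finally show ?case using unsold by blast
qed

lemma expectation_VT_history:
  assumes "\<forall>t\<in>{1..T}. V t \<in> r ` {0..m}"
  shows "measure_pmf.expectation (VT_history m r pick V T) revenue =
           1 / (\<Sum>j = 1..m. q r j) * OPT k T V"
proof -
  have "\<forall>t\<in>{1..T}. 0 \<le> V t" using assms r_nonneg by fastforce
  then show ?thesis
    using expectation_VT_run[OF assms] sum_levels_eq_OPT[of T V]
    by (simp add: VT_history_def Q_def case_prod_unfold)
qed

section \<open>Comparing the laws of Exp and VT under random valuations\<close>

definition VT_law :: "(nat \<Rightarrow> real pmf) \<Rightarrow> nat \<Rightarrow> ((nat \<Rightarrow> real) \<times> (nat \<Rightarrow> bool) \<times> history) pmf" where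
  "VT_law v t = bind_pmf (valuations t v) (\<lambda>V. VT_run m r pick V t)"

definition Exp_law :: "(nat \<Rightarrow> real pmf) \<Rightarrow> nat \<Rightarrow> history pmf" where
  "Exp_law v t = bind_pmf (valuations t v) (\<lambda>V. public_run (Exp_alg m k r pick) v V t)"

abbreviation "VT_state_price \<equiv> \<lambda>(lv, sd, h :: history). VT_price m r pick lv sd"

definition VT_update ::
    "(nat \<Rightarrow> real) \<times> (nat \<Rightarrow> bool) \<times> history \<Rightarrow> ereal \<Rightarrow> real \<Rightarrow> (nat \<Rightarrow> real) \<times> (nat \<Rightarrow> bool) \<times> history" where
  "VT_update = (\<lambda>(lv, sd, h) p y. (lv(pick lv := max (lv (pick lv)) y),
      sd(pick lv := sd (pick lv) \<or> p \<le> ereal y), h @ [(p, p \<le> ereal y)]))"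

lemma VT_law_Suc:
  "VT_law v (Suc t) = bind_pmf (VT_law v t) (\<lambda>s. bind_pmf (VT_state_price s)
     (\<lambda>p. bind_pmf (v (Suc t)) (\<lambda>y. return_pmf (VT_update s p y))))"
  unfolding VT_law_def
proof (rule bind_valuations_Suc)
  show "VT_run m r pick V (Suc t) = bind_pmf (VT_run m r pick V t) (\<lambda>s. bind_pmf (VT_state_price s)
     (\<lambda>p. return_pmf (VT_update s p (V (Suc t)))))" for V
    by (simp add: Let_def VT_update_def case_prod_unfold)
qed (rule VT_run_cong, simp)

lemma Exp_law_Suc:
  "Exp_law v (Suc t) = bind_pmf (Exp_law v t) (\<lambda>h. bind_pmf (Exp_alg m k r pick (map v [1..<Suc t]) h)
     (\<lambda>p. bind_pmf (v (Suc t)) (\<lambda>y. return_pmf (h @ [(p, p \<le> ereal y)]))))"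
  unfolding Exp_law_def
  by (rule bind_valuations_Suc) (simp, rule public_run_cong, simp)

text \<open>Identifies the run simulated inside \<open>Exp_alg\<close> with the actual VT run under
  \<open>v\<close>. Customers count from 1 and list positions from 0, so entry \<open>s - 1\<close>
  is \<open>v s\<close>.\<close>

lemma VT_inventory_price_eq:
  "VT_inventory_price m k r pick (map v [1..<Suc t]) =
     inventory_price k (\<lambda>s. snd (snd s)) (VT_law v t) VT_state_price"
proof -
  have "valuations t (\<lambda>s. map v [1..<Suc t] ! (s - 1)) = valuations t v"
    by (rule valuations_cong) (auto simp del: upt_Suc)
  then show ?thesis
    by (simp add: VT_inventory_price_def inventory_price_def VT_law_def bind_assoc_pmf
        case_prod_unfold map_pmf_def del: upt_Suc)
qed

lemma VT_law_valid:
  assumes "\<forall>s\<in>{1..t}. valuation_dist m r (v s)" "x \<in> set_pmf (VT_law v t)"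
  shows "valid_state t x"
proof -
  obtain V where V: "V \<in> set_pmf (valuations t v)" "x \<in> set_pmf (VT_run m r pick V t)"
    using assms(2) by (auto simp: VT_law_def)
  have "\<forall>s\<in>{1..t}. V s \<in> r ` {0..m}"
    using set_valuations[OF V(1)] assms(1) by (fastforce simp: valuation_dist_def)
  then show ?thesis using VT_run_valid V(2) by blast
qed

lemma finite_VT_law:
  assumes "\<forall>s\<in>{1..t}. valuation_dist m r (v s)"
  shows "finite (set_pmf (VT_law v t))"
  unfolding VT_law_def
proof (rule finite_set_bind_pmf)
  show "finite (set_pmf (valuations t v))"
    using assms by (auto intro!: finite_set_valuations finite_valuation_dist)
  fix V assume "V \<in> set_pmf (valuations t v)"
  then have "\<forall>s\<in>{1..t}. V s \<in> r ` {0..m}"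
    using set_valuations assms by (fastforce simp: valuation_dist_def)
  then show "finite (set_pmf (VT_run m r pick V t))" by (rule finite_VT_run)
qed

text \<open>When no inventory is left, at least \<open>k\<close> units are sold; as sold units lie
  in \<open>{1..k}\<close>, all of them are, including the selected one, and VT posts
  \<open>\<infinity>\<close>.\<close>

lemma set_VT_inventory_price:
  assumes v: "\<forall>s\<in>{1..t}. valuation_dist m r (v s)"
    and ip: "(i, p) \<in> set_pmf (VT_inventory_price m k r pick (map v [1..<Suc t]))"
  shows "p \<in> price m r ` {1..m + 1} \<and> (i \<le> 0 \<longrightarrow> p = \<infinity>)"
proof -
  obtain lv sd h where s: "(lv, sd, h) \<in> set_pmf (VT_law v t)"
    "i = inventory k h" "p \<in> set_pmf (VT_price m r pick lv sd)"
    using ip unfolding VT_inventory_price_eq by (auto simp: inventory_price_def)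
  note valid = VT_law_valid[OF v s(1)]
  have "p = \<infinity>" if "i \<le> 0"
  proof -
    have "{i. sd i} = {1..k}"
      using valid that s(2) by (intro card_seteq) (auto simp: valid_state_def inventory_def)
    with pick_mem[of lv] have "sd (pick lv)" by blast
    with s(3) show ?thesis by (simp add: VT_price_def)
  qed
  then show ?thesis using set_VT_price[OF valid] s(3) by blast
qed

lemma infty_price: "\<infinity> \<in> price m r ` {1..m + 1}"
  by (auto simp: price_def image_iff intro!: bexI[of _ "m + 1"])

lemma Exp_alg_cond:
  assumes "inventory k h \<in> fst ` set_pmf (VT_inventory_price m k r pick vs)"
  shows "Exp_alg m k r pick vs h =
    map_pmf snd (cond_pmf (VT_inventory_price m k r pick vs) {(i, p). i = inventory k h})"
proof -
  let ?D = "VT_inventory_price m k r pick vs"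
  obtain p where "(inventory k h, p) \<in> set_pmf ?D" using assms by auto
  then have "measure_pmf.prob ?D {(i, p). i = inventory k h} > 0"
    by (intro measure_pmf_posI[of "(inventory k h, p)"]) auto
  then show ?thesis by (simp add: Exp_alg_def)
qed

text \<open>Conditioning does not enlarge the support, so Exp inherits the admissible prices and the
  out-of-stock rule from VT; the fallback price \<open>\<infinity>\<close> satisfies both.\<close>

lemma Exp_alg_public: "public_pricing_algorithm m k r (Exp_alg m k r pick)"
  unfolding public_pricing_algorithm_def
proof (intro allI impI)
  fix vs :: "real pmf list" and h :: history
  assume vs: "\<forall>v\<in>set vs. valuation_dist m r v"
  define v where "v s = vs ! (s - 1)" for s
  have v: "\<forall>s\<in>{1..length vs}. valuation_dist m r (v s)" using vs by (auto simp: v_def)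
  have vs_eq: "vs = map v [1..<Suc (length vs)]"
    by (rule nth_equalityI) (auto simp: v_def simp del: upt_Suc)
  let ?D = "VT_inventory_price m k r pick vs"
  have D: "p \<in> price m r ` {1..m + 1}" "i \<le> 0 \<Longrightarrow> p = \<infinity>" if "(i, p) \<in> set_pmf ?D" for i p
    using set_VT_inventory_price[OF v, of i p] that unfolding vs_eq[symmetric] by auto
  show "set_pmf (Exp_alg m k r pick vs h) \<subseteq> price m r ` {1..m + 1} \<and>
      (inventory k h \<le> 0 \<longrightarrow> Exp_alg m k r pick vs h = return_pmf \<infinity>)"
  proof (cases "inventory k h \<in> fst ` set_pmf ?D")
    case True
    let ?E = "{(i, p). i = inventory k h}"
    have "set_pmf ?D \<inter> ?E \<noteq> {}" using True by auto
    then have set: "set_pmf (Exp_alg m k r pick vs h) = snd ` (set_pmf ?D \<inter> ?E)"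
      by (simp add: Exp_alg_cond[OF True] set_cond_pmf)
    have "set_pmf (Exp_alg m k r pick vs h) \<subseteq> {\<infinity>}" if "inventory k h \<le> 0"
      unfolding set using D(2) that by auto
    then have "inventory k h \<le> 0 \<longrightarrow> Exp_alg m k r pick vs h = return_pmf \<infinity>"
      by (simp add: set_pmf_subset_singleton)
    then show ?thesis using D(1) unfolding set by auto
  next
    case False
    then have "set_pmf ?D \<inter> {(i, p). i = inventory k h} = {}" by force
    then have "measure_pmf.prob ?D {(i, p). i = inventory k h} = 0"
      by (simp add: measure_pmf_zero_iff)
    then have "Exp_alg m k r pick vs h = return_pmf \<infinity>" by (simp add: Exp_alg_def)
    then show ?thesis using infty_price by simp
  qed
qed

lemma finite_Exp_alg:
  assumes "\<forall>s\<in>{1..t}. valuation_dist m r (v s)" "length h = t"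
  shows "finite (set_pmf (Exp_alg m k r pick (map v [1..<Suc t]) h))"
proof -
  have "set_pmf (Exp_alg m k r pick (map v [1..<Suc t]) h) \<subseteq> price m r ` {1..m + 1}"
    using Exp_alg_public assms unfolding public_pricing_algorithm_def
    by (auto simp del: upt_Suc)
  then show ?thesis by (rule finite_subset) simp
qed

lemma length_Exp_law: "h \<in> set_pmf (Exp_law v t) \<Longrightarrow> length h = t"
  by (auto simp: Exp_law_def dest: length_public_run)

text \<open>Exp draws its price from the conditional law of the VT price given the inventory, so
  agreement of the inventory marginals extends to the joint laws.\<close>

lemma Exp_VT_inventory_price:
  assumes "map_pmf (inventory k) (Exp_law v t) = map_pmf (\<lambda>s. inventory k (snd (snd s))) (VT_law v t)"
  shows "inventory_price k (\<lambda>h. h) (Exp_law v t) (Exp_alg m k r pick (map v [1..<Suc t])) =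
     inventory_price k (\<lambda>s. snd (snd s)) (VT_law v t) VT_state_price"
  unfolding VT_inventory_price_eq[symmetric]
proof (rule inventory_price_conditional)
  show "map_pmf fst (VT_inventory_price m k r pick (map v [1..<Suc t])) = map_pmf (inventory k) (Exp_law v t)"
    unfolding VT_inventory_price_eq map_fst_inventory_price assms ..
qed (rule Exp_alg_cond)

lemma snd_snd_VT_update: "snd (snd (VT_update s p y)) = snd (snd s) @ [(p, p \<le> ereal y)]"
  by (simp add: VT_update_def case_prod_unfold)

text \<open>In the induction, equal inventory laws give equal joint laws with the next price, and
  \<open>inventory_step\<close> sends these to the next inventory law by the same map for both
  algorithms.\<close>

lemma Exp_law_inventory:
  "map_pmf (inventory k) (Exp_law v t) = map_pmf (\<lambda>s. inventory k (snd (snd s))) (VT_law v t)"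
proof (induction t)
  case 0
  show ?case by (simp add: Exp_law_def VT_law_def map_bind_pmf)
next
  case (Suc t)
  show ?case
    unfolding Exp_law_Suc VT_law_Suc
    by (subst inventory_step[where hist = "\<lambda>s. snd (snd s)"], rule snd_snd_VT_update,
        subst inventory_step[where hist = "\<lambda>h. h"], rule refl,
        simp only: Exp_VT_inventory_price[OF Suc.IH])
qed

lemma Exp_law_finite:
  "\<forall>s\<in>{1..t}. valuation_dist m r (v s) \<Longrightarrow> finite (set_pmf (Exp_law v t))"
proof (induction t)
  case 0
  show ?case by (simp add: Exp_law_def valuations_def)
next
  case (Suc t)
  then show ?case
    unfolding Exp_law_Suc
    by (intro finite_set_bind_pmf finite_Exp_alg length_Exp_law)
       (auto intro: finite_valuation_dist)
qed

text \<open>By \<open>revenue_step\<close> the increments from each customer are the same function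
  of the same joint law, so the totals agree by induction.\<close>

lemma expectation_Exp_law:
  "\<forall>s\<in>{1..t}. valuation_dist m r (v s) \<Longrightarrow>
     measure_pmf.expectation (Exp_law v t) revenue =
     measure_pmf.expectation (VT_law v t) (\<lambda>s. revenue (snd (snd s)))"
proof (induction t)
  case 0
  show ?case by (simp add: Exp_law_def VT_law_def valuations_def)
next
  case (Suc t)
  then have v: "\<forall>s\<in>{1..t}. valuation_dist m r (v s)" "finite (set_pmf (v (Suc t)))"
    by (auto intro: finite_valuation_dist)
  have VT: "finite (set_pmf (VT_state_price s))" if "s \<in> set_pmf (VT_law v t)" for s
    using VT_law_valid[OF v(1) that] by (cases s) (auto intro: finite_VT_price)
  show ?case
    unfolding Exp_law_Suc VT_law_Suc
    using revenue_step[where hist = "\<lambda>h. h" and k = k and U = "\<lambda>h p y. h @ [(p, p \<le> ereal y)]",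
        OF refl Exp_law_finite[OF v(1)] finite_Exp_alg[OF v(1) length_Exp_law] v(2)]
      revenue_step[where hist = "\<lambda>s. snd (snd s)" and k = k,
        OF snd_snd_VT_update finite_VT_law[OF v(1)] VT v(2)]
      Suc.IH[OF v(1)] Exp_VT_inventory_price[OF Exp_law_inventory]
    by simp
qed

section \<open>Revenue equality and competitiveness\<close>

lemma expected_revenue_Exp:
  assumes "\<forall>t\<in>{1..T}. valuation_dist m r (v t)"
  shows "expected_revenue (Exp_alg m k r pick) v T =
    measure_pmf.expectation (bind_pmf (valuations T v) (\<lambda>V. VT_history m r pick V T)) revenue"
proof -
  have "bind_pmf (valuations T v) (\<lambda>V. VT_history m r pick V T) = map_pmf (\<lambda>s. snd (snd s)) (VT_law v T)"
    by (simp add: VT_law_def VT_history_def map_bind_pmf case_prod_unfold)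
  then show ?thesis
    using expectation_Exp_law[OF assms] by (simp add: expected_revenue_def Exp_law_def)
qed

text \<open>The bound is attained with equality: the identity for each realization is averaged over
  the valuations.\<close>

lemma Exp_competitive: "competitive m k r (c_star m r) (Exp_alg m k r pick)"
  unfolding competitive_def
proof (intro allI impI)
  fix T and v :: "nat \<Rightarrow> real pmf"
  assume v: "\<forall>t\<in>{1..T}. valuation_dist m r (v t)"
  have V: "\<forall>t\<in>{1..T}. V t \<in> r ` {0..m}" if "V \<in> set_pmf (valuations T v)" for V
    using set_valuations[OF that] v by (fastforce simp: valuation_dist_def)
  have "expected_revenue (Exp_alg m k r pick) v T =
      measure_pmf.expectation (valuations T v) (\<lambda>V. measure_pmf.expectation (VT_history m r pick V T) revenue)"
    unfolding expected_revenue_Exp[OF v]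
    by (rule expectation_bind_finite)
       (use v V in \<open>auto simp: VT_history_def intro!: finite_set_valuations finite_valuation_dist finite_VT_run\<close>)
  also have "\<dots> = measure_pmf.expectation (valuations T v) (\<lambda>V. c_star m r * OPT k T V)"
    unfolding c_star_def by (rule expectation_cong_pmf) (rule expectation_VT_history[OF V])
  finally show "c_star m r * measure_pmf.expectation (valuations T v) (OPT k T) \<le>
      expected_revenue (Exp_alg m k r pick) v T"
    by simp
qed

end


theorem theorem4:
  fixes m k :: nat
    and r :: "nat \<Rightarrow> real"
    and pick :: "(nat \<Rightarrow> real) \<Rightarrow> nat"
  assumes "m \<ge> 1"
    and "k \<ge> 1"
    and "r 0 = 0"
    and "strict_mono_on {0..m} r"
    and "tie_breaking k pick"
  shows "(\<forall>T \<ge> 1. \<forall>v. (\<forall>t \<in> {1..T}. valuation_dist m r (v t)) \<longrightarrow>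
            expected_revenue (Exp_alg m k r pick) v T =
            measure_pmf.expectation
              (do { V \<leftarrow> valuations T v; VT_history m r pick V T }) revenue)
       \<and> (\<forall>T \<ge> 1. \<forall>V. (\<forall>t \<in> {1..T}. V t \<in> r ` {0..m}) \<longrightarrow>
            measure_pmf.expectation (VT_history m r pick V T) revenue =
            1 / (\<Sum>j = 1..m. q r j) * OPT k T V)
       \<and> public_pricing_algorithm m k r (Exp_alg m k r pick)
       \<and> competitive m k r (c_star m r) (Exp_alg m k r pick)"
proof -
  interpret vt m k r pick
    by unfold_locales (use assms in auto)
  show ?thesis
    using expected_revenue_Exp expectation_VT_history Exp_alg_public Exp_competitive by blast
qed

end
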